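(* Let $(X,\preccurlyeq)$ be a nonempty partially ordered set, $P$ a predicate on $X$, and $f\in\mathfrak{UM}(P)$. Define $G:X\to\mathcal P(X)$ by $$G(x)=\{y\in X\mid y\preccurlyeq x\}\cap f(x),\qquad x\in X,$$ and let $Y=\{y\in X\mid G(y)\neq\varnothing\}$. Let $g:Y\to Y$ be a function such that for every $x\in Y$: $g(x)$ is the greatest element of $G(x)$ if $G(x)$ has a greatest element, and $g(x)$ is some element of $G(x)$ otherwise. Then $g$ is restrictive on $(Y,\preccurlyeq)$ and $\{x\in Y\mid g(x)=x\}=P^{-1}(1)$.
   Context: $\mathcal P(X)$ is the power set of $X$. A predicate on $X$ is a function $P:X\to\{0,1\}$ with truth set $P^{-1}(1)=\{x\in X\mid P(x)=1\}$. $\mathfrak{UM}(P)$ is the set of all multifunctions $f:X\to\mathcal P(X)$ such that $\{x\in X\mid x\in f(x)\}=P^{-1}(1)$. A function $g:Y\to Y$ on a partially ordered set $(Y,\preccurlyeq)$ is restrictive if $g(x)\preccurlyeq x$ for every $x\in Y$. *)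

theory Defs
  imports "HOL-Algebra.Order"
begin

text \<open>A poset is a record \<open>L\<close> satisfying \<open>partial_order L\<close>, so its equality is the logical one; the
  underlying set is \<open>carrier L\<close>.  A predicate on a set takes values in \<open>bool\<close>, with \<open>True\<close> for 1.
  Functions between sets are members of \<open>A \<rightarrow> B\<close>; their values outside \<open>A\<close> are irrelevant.\<close>

definition truth_set :: "'a set \<Rightarrow> ('a \<Rightarrow> bool) \<Rightarrow> 'a set" where
  "truth_set X P = {x \<in> X. P x}"

definition UM :: "'a set \<Rightarrow> ('a \<Rightarrow> bool) \<Rightarrow> ('a \<Rightarrow> 'a set) set" where
  "UM X P = {f \<in> X \<rightarrow> Pow X. {x \<in> X. x \<in> f x} = truth_set X P}"

text \<open>Meant for self-maps \<open>g \<in> carrier L \<rightarrow> carrier L\<close>.\<close>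

definition restrictive :: "('a, 'b) gorder_scheme \<Rightarrow> ('a \<Rightarrow> 'a) \<Rightarrow> bool" where
  "restrictive L g \<longleftrightarrow> (\<forall>x \<in> carrier L. g x \<sqsubseteq>\<^bsub>L\<^esub> x)"

end

theory Submission
  imports Defs
begin

text \<open>Each \<open>g x\<close> lies in \<open>G x\<close> in either case of the choice, hence below \<open>x\<close>: this is restrictivity. For
  the fixed points, the point is that \<open>x\<close> is an upper bound of \<open>G x\<close>, so as soon as \<open>x \<in> f x\<close>,
  reflexivity puts \<open>x\<close> itself into \<open>G x\<close> as its greatest element. The choice is then forced,
  by antisymmetry, to be \<open>x\<close>. Conversely \<open>g x = x\<close> gives \<open>x \<in> G x \<subseteq> f x\<close>, and the points with
  \<open>x \<in> f x\<close> are those satisfying \<open>P\<close>.\<close>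

theorem lemma3p4:
  fixes L :: "('a, 'b) gorder_scheme"
    and P :: "'a \<Rightarrow> bool"
    and f G :: "'a \<Rightarrow> 'a set"
    and Y :: "'a set"
    and g :: "'a \<Rightarrow> 'a"
  assumes "partial_order L"
    and "carrier L \<noteq> {}"
    and "f \<in> UM (carrier L) P"
    and "\<And>x. x \<in> carrier L \<Longrightarrow> G x = {y \<in> carrier L. y \<sqsubseteq>\<^bsub>L\<^esub> x} \<inter> f x"
    and "Y = {y \<in> carrier L. G y \<noteq> {}}"
    and "g \<in> Y \<rightarrow> Y"
    and "\<And>x. x \<in> Y \<Longrightarrow>
           (if \<exists>m. greatest L m (G x) then greatest L (g x) (G x) else g x \<in> G x)"
  shows "restrictive (L\<lparr>carrier := Y\<rparr>) g \<and> {x \<in> Y. g x = x} = truth_set (carrier L) P"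
proof -
  interpret partial_order L by fact
  have g_in: "g x \<in> G x" if "x \<in> Y" for x
    using assms(7)[OF that] by (auto simp: greatest_def split: if_splits)
  have Y_carrier: "x \<in> carrier L" if "x \<in> Y" for x
    using that assms(5) by blast
  have truth: "truth_set (carrier L) P = {x \<in> carrier L. x \<in> f x}"
    using assms(3) by (simp add: UM_def)
  have below: "g x \<sqsubseteq>\<^bsub>L\<^esub> x" if "x \<in> Y" for x
    using g_in[OF that] assms(4)[OF Y_carrier[OF that]] by blast
  have forced: "x \<in> Y \<and> g x = x" if x: "x \<in> carrier L" "x \<in> f x" for x
  proof -
    have gr: "greatest L x (G x)"
      using x assms(4)[OF x(1)] by (auto simp: greatest_def)
    then have xG: "x \<in> G x"
      by (simp add: greatest_def)
    then have xY: "x \<in> Y"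
      using x(1) assms(5) by blast
    then have "greatest L (g x) (G x)"
      using assms(7) gr by metis
    then have "g x = x"
      using gr by (rule greatest_unique)
    with xY show ?thesis by simp
  qed
  have fixed: "x \<in> f x" if "x \<in> Y" "g x = x" for x
    using g_in[OF that(1)] that(2) assms(4)[OF Y_carrier[OF that(1)]] by simp
  show ?thesis
  proof
    show "restrictive (L\<lparr>carrier := Y\<rparr>) g"
      using below by (simp add: restrictive_def)
    show "{x \<in> Y. g x = x} = truth_set (carrier L) P"
      unfolding truth using forced fixed Y_carrier by blast
  qed
qed

end
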